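(* Suppose the DAE $\dot y=f(y,z,t)$, $0=g(y,t)$ is Hessenberg index-2 with true solution $[y,z]^T$, and let $[Y,Z]^T$ be its numerical solution. Let $(\phi^{(y)},\phi^{(z)})$ solve the adjoint problem $$-\dot{\phi}^{(y)}=\bar f_y^T\phi^{(y)}+\bar g_y^T\phi^{(z)}+\psi^y,\qquad 0=\bar f_z^T\phi^{(y)}+\psi^z,\qquad t\in[0,T),$$ with $$\phi^{(y)}(T)=-\bar g_y^T\left(\bar f_z^T\bar g_y^T\right)^{-1}\psi^z\Bigr|_{t=T}.$$ Then the error $e^{\mathcal{Q}_{[0,T]}}=\langle e^{(y)},\psi^y\rangle+\langle e^{(z)},\psi^z\rangle$ in the computed quantity of interest $\mathcal{Q}_{[0,T]}(Y,Z)$ is given by $$e^{\mathcal{Q}_{[0,T]}}=\big(\phi^{(y)}(0),e^{(y)}(0)\big)+\langle\phi^{(y)},f(Y,Z)-\dot Y\rangle+\langle\phi^{(z)},g(Y)\rangle.$$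
   Context: Setting: $y(t)\in\mathbb{R}^n$, $z(t)\in\mathbb{R}^m$, $t\in[0,T]$; $f$ takes values in $\mathbb{R}^n$, $g$ in $\mathbb{R}^m$, both smooth enough that all derivatives that appear exist and are continuous. The DAE is Hessenberg index-2 if $g$ does not depend on $z$ and $g_yf_z\in\mathbb{R}^{m\times m}$ is invertible in a neighborhood of the solution (subscripts denote Jacobians). Explicit dependence on $t$ is suppressed: $f(Y,Z)$ means $f(Y(t),Z(t),t)$, $g(Y)$ means $g(Y(t),t)$. Numerical solution: with $t_k=k\Delta t$, $\Delta t=T/N$ (so $t_N=T$), $Y_0=y(0)$, $Z_0=z(0)$, the values satisfy the BDF-1 (implicit Euler) equations $Y_{k+1}=Y_k+\Delta t\,f(Y_{k+1},Z_{k+1},t_{k+1})$, $0=g(Y_{k+1},t_{k+1})$, $k=0,\dots,N-1$. $Y(t),Z(t)$ are the continuous piecewise linear interpolants of these values. The derivative $\dot Y$ is taken piecewise. $e^{(y)}=y-Y$, $e^{(z)}=z-Z$. $(\cdot,\cdot)$ is the Euclidean inner product and $\langle a,b\rangle=\int_0^T(a(t),b(t))\,dt$. For given $\psi^y\in[L^2(0,T)]^n$, $\psi^z\in[L^2(0,T)]^m$ (with $\psi^z$ regular enough in time, e.g. differentiable up to $t=T$, that $\psi^z(T)$ is defined), $\mathcal{Q}_{[0,T]}(y,z)=\langle y,\psi^y\rangle+\langle z,\psi^z\rangle$ and $e^{\mathcal{Q}_{[0,T]}}=\mathcal{Q}_{[0,T]}(y,z)-\mathcal{Q}_{[0,T]}(Y,Z)$.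 Linearized operators (functions of $t$): $\bar f_y=\int_0^1\frac{\partial f}{\partial y}(\tilde y,\tilde z,t)ds$, $\bar f_z=\int_0^1\frac{\partial f}{\partial z}(\tilde y,\tilde z,t)ds$, $\bar g_y=\int_0^1\frac{\partial g}{\partial y}(\tilde y,t)ds$, with $\tilde y=sy+(1-s)Y$, $\tilde z=sz+(1-s)Z$; since $g$ is independent of $z$, the operator $\bar g_z$ vanishes. Adjoint variables: $\phi^{(y)}(t)\in\mathbb{R}^n$ is continuous on $[0,T]$ (absolutely continuous, equations holding for almost every $t$), $\phi^{(z)}(t)\in\mathbb{R}^m$ is square integrable, initialized consistently with the DAE at $t=T$ (the single value $\phi^{(z)}(T)$ does not enter the claim). The numerical solution is assumed close enough to the true one that $\bar f_z^T\bar g_y^T$ is invertible. *)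

theory Defs
  imports "HOL-Analysis.Analysis"
begin

text \<open>Jacobians of \<open>f(y,z,t)\<close> with respect to \<open>y\<close> and \<open>z\<close>, and of \<open>g(y,t)\<close> with respect
  to \<open>y\<close>.\<close>

definition f_y :: "(real^'n \<Rightarrow> real^'m \<Rightarrow> real \<Rightarrow> real^'n) \<Rightarrow> real^'n \<Rightarrow> real^'m \<Rightarrow> real \<Rightarrow> real^'n^'n"
  where "f_y f a b t = jacobian (\<lambda>a'. f a' b t) (at a)"

definition f_z :: "(real^'n \<Rightarrow> real^'m \<Rightarrow> real \<Rightarrow> real^'n) \<Rightarrow> real^'n \<Rightarrow> real^'m \<Rightarrow> real \<Rightarrow> real^'m^'n"
  where "f_z f a b t = jacobian (\<lambda>b'. f a b' t) (at b)"

definition g_y :: "(real^'n \<Rightarrow> real \<Rightarrow> real^'m) \<Rightarrow> real^'n \<Rightarrow> real \<Rightarrow> real^'n^'m"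
  where "g_y g a t = jacobian (\<lambda>a'. g a' t) (at a)"

text \<open>Smoothness of the data on domains \<open>D\<close> (of \<open>f\<close>) and \<open>E\<close> (of \<open>g\<close>) that are relatively open
  in the time strip \<open>[0,T]\<close>. Only the derivatives occurring in the adjoint problem are required;
  globally defined data are the case \<open>D = UNIV \<times> UNIV \<times> {0..T}\<close>, \<open>E = UNIV \<times> {0..T}\<close>.\<close>

definition smooth_f ::
  "real \<Rightarrow> ((real^'n) \<times> (real^'m) \<times> real) set \<Rightarrow> (real^'n \<Rightarrow> real^'m \<Rightarrow> real \<Rightarrow> real^'n) \<Rightarrow> bool"
  where "smooth_f T D f \<longleftrightarrow>
    openin (top_of_set (UNIV \<times> UNIV \<times> {0..T})) D \<and>
    continuous_on D (\<lambda>(a, b, t). f a b t) \<and>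
    (\<forall>(a, b, t)\<in>D. (\<lambda>a'. f a' b t) differentiable (at a) \<and> (\<lambda>b'. f a b' t) differentiable (at b)) \<and>
    continuous_on D (\<lambda>(a, b, t). f_y f a b t) \<and>
    continuous_on D (\<lambda>(a, b, t). f_z f a b t)"

definition smooth_g ::
  "real \<Rightarrow> ((real^'n) \<times> real) set \<Rightarrow> (real^'n \<Rightarrow> real \<Rightarrow> real^'m) \<Rightarrow> bool"
  where "smooth_g T E g \<longleftrightarrow>
    openin (top_of_set (UNIV \<times> {0..T})) E \<and>
    continuous_on E (\<lambda>(a, t). g a t) \<and>
    (\<forall>(a, t)\<in>E. (\<lambda>a'. g a' t) differentiable (at a)) \<and>
    continuous_on E (\<lambda>(a, t). g_y g a t)"

text \<open>Classical solution of \<open>y' = f(y,z,t)\<close>, \<open>0 = g(y,t)\<close> on \<open>[0,T]\<close> (one-sided derivatives at the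
  end points).\<close>

definition dae_solution ::
  "real \<Rightarrow> (real^'n \<Rightarrow> real^'m \<Rightarrow> real \<Rightarrow> real^'n) \<Rightarrow> (real^'n \<Rightarrow> real \<Rightarrow> real^'m) \<Rightarrow>
    (real \<Rightarrow> real^'n) \<Rightarrow> (real \<Rightarrow> real^'m) \<Rightarrow> bool"
  where "dae_solution T f g y z \<longleftrightarrow>
    continuous_on {0..T} z \<and>
    (\<forall>t\<in>{0..T}. (y has_vector_derivative f (y t) (z t) t) (at t within {0..T}) \<and> g (y t) t = 0)"

text \<open>The algebraic constraint does not involve \<open>z\<close> (by the type of \<open>g\<close>), and \<open>g_y f_z\<close> is
  invertible in a neighbourhood of the solution.\<close>

definition hessenberg_index2 ::
  "real \<Rightarrow> ((real^'n) \<times> (real^'m) \<times> real) set \<Rightarrow> ((real^'n) \<times> real) set \<Rightarrow>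
    (real^'n \<Rightarrow> real^'m \<Rightarrow> real \<Rightarrow> real^'n) \<Rightarrow> (real^'n \<Rightarrow> real \<Rightarrow> real^'m) \<Rightarrow>
    (real \<Rightarrow> real^'n) \<Rightarrow> (real \<Rightarrow> real^'m) \<Rightarrow> bool"
  where "hessenberg_index2 T D E f g y z \<longleftrightarrow>
    (\<exists>U. openin (top_of_set (UNIV \<times> UNIV \<times> {0..T})) U \<and> U \<subseteq> D \<and>
      (\<forall>t\<in>{0..T}. (y t, z t, t) \<in> U) \<and>
      (\<forall>(a, b, t)\<in>U. (a, t) \<in> E \<and> invertible (g_y g a t ** f_z f a b t)))"

text \<open>Nodal values of the BDF-1 (implicit Euler) method on the uniform grid \<open>t\<^sub>k = k T / N\<close>.\<close>

definition bdf1 ::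
  "real \<Rightarrow> nat \<Rightarrow> (real^'n \<Rightarrow> real^'m \<Rightarrow> real \<Rightarrow> real^'n) \<Rightarrow> (real^'n \<Rightarrow> real \<Rightarrow> real^'m) \<Rightarrow>
    (nat \<Rightarrow> real^'n) \<Rightarrow> (nat \<Rightarrow> real^'m) \<Rightarrow> bool"
  where "bdf1 T N f g Yn Zn \<longleftrightarrow>
    (\<forall>k<N. let \<Delta>t = T / real N; t' = real (Suc k) * \<Delta>t in
       Yn (Suc k) = Yn k + \<Delta>t *\<^sub>R f (Yn (Suc k)) (Zn (Suc k)) t' \<and>
       0 = g (Yn (Suc k)) t')"

text \<open>Continuous piecewise linear interpolant on \<open>[0,T]\<close>; the cap \<open>N - 1\<close> puts \<open>t = T\<close> into the last
  cell.\<close>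

definition pl_interp :: "real \<Rightarrow> nat \<Rightarrow> (nat \<Rightarrow> 'a::real_vector) \<Rightarrow> real \<Rightarrow> 'a"
  where "pl_interp T N v t =
    (let \<Delta>t = T / real N; k = min (nat \<lfloor>t / \<Delta>t\<rfloor>) (N - 1); \<theta> = t / \<Delta>t - real k
     in (1 - \<theta>) *\<^sub>R v k + \<theta> *\<^sub>R v (Suc k))"

definition L2_on :: "real \<Rightarrow> (real \<Rightarrow> 'a::euclidean_space) \<Rightarrow> bool"
  where "L2_on T u \<longleftrightarrow>
    u \<in> borel_measurable (lebesgue_on {0..T}) \<and>
    integrable (lebesgue_on {0..T}) (\<lambda>t. (norm (u t))\<^sup>2)"

definition ip :: "real \<Rightarrow> (real \<Rightarrow> 'a::euclidean_space) \<Rightarrow> (real \<Rightarrow> 'a) \<Rightarrow> real"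
  where "ip T a b = (LINT t|lebesgue_on {0..T}. a t \<bullet> b t)"

definition QoI ::
  "real \<Rightarrow> (real \<Rightarrow> real^'n) \<Rightarrow> (real \<Rightarrow> real^'m) \<Rightarrow> (real \<Rightarrow> real^'n) \<Rightarrow> (real \<Rightarrow> real^'m) \<Rightarrow> real"
  where "QoI T \<psi>y \<psi>z y z = ip T y \<psi>y + ip T z \<psi>z"

text \<open>Absolute continuity on \<open>[a,b]\<close>: the usual epsilon-delta condition over finite families of
  non-overlapping subintervals, each given by its pair of end points.\<close>

definition abs_continuous_on :: "real \<Rightarrow> real \<Rightarrow> (real \<Rightarrow> 'a::real_normed_vector) \<Rightarrow> bool"
  where "abs_continuous_on a b u \<longleftrightarrow>
    (\<forall>\<epsilon>>0. \<exists>\<delta>>0. \<forall>P.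
      finite P \<and> (\<forall>(p, q)\<in>P. a \<le> p \<and> p \<le> q \<and> q \<le> b) \<and>
      pairwise (\<lambda>I J. {fst I<..<snd I} \<inter> {fst J<..<snd J} = {}) P \<and>
      (\<Sum>(p, q)\<in>P. q - p) < \<delta> \<longrightarrow>
      (\<Sum>(p, q)\<in>P. norm (u q - u p)) < \<epsilon>)"

text \<open>Jacobians averaged over the segment from \<open>(Y(t),Z(t))\<close> to \<open>(y(t),z(t))\<close>.\<close>

definition fbar_y ::
  "(real^'n \<Rightarrow> real^'m \<Rightarrow> real \<Rightarrow> real^'n) \<Rightarrow> (real \<Rightarrow> real^'n) \<Rightarrow> (real \<Rightarrow> real^'m) \<Rightarrow>
    (real \<Rightarrow> real^'n) \<Rightarrow> (real \<Rightarrow> real^'m) \<Rightarrow> real \<Rightarrow> real^'n^'n"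
  where "fbar_y f y z Y Z t = integral {0..1}
    (\<lambda>s. f_y f (s *\<^sub>R y t + (1 - s) *\<^sub>R Y t) (s *\<^sub>R z t + (1 - s) *\<^sub>R Z t) t)"

definition fbar_z ::
  "(real^'n \<Rightarrow> real^'m \<Rightarrow> real \<Rightarrow> real^'n) \<Rightarrow> (real \<Rightarrow> real^'n) \<Rightarrow> (real \<Rightarrow> real^'m) \<Rightarrow>
    (real \<Rightarrow> real^'n) \<Rightarrow> (real \<Rightarrow> real^'m) \<Rightarrow> real \<Rightarrow> real^'m^'n"
  where "fbar_z f y z Y Z t = integral {0..1}
    (\<lambda>s. f_z f (s *\<^sub>R y t + (1 - s) *\<^sub>R Y t) (s *\<^sub>R z t + (1 - s) *\<^sub>R Z t) t)"

definition gbar_y ::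
  "(real^'n \<Rightarrow> real \<Rightarrow> real^'m) \<Rightarrow> (real \<Rightarrow> real^'n) \<Rightarrow> (real \<Rightarrow> real^'n) \<Rightarrow> real \<Rightarrow> real^'n^'m"
  where "gbar_y g y Y t = integral {0..1} (\<lambda>s. g_y g (s *\<^sub>R y t + (1 - s) *\<^sub>R Y t) t)"

text \<open>Adjoint problem with coefficient matrices \<open>A = fbar_y\<close>, \<open>B = fbar_z\<close>, \<open>C = gbar_y\<close>, in the
  Caratheodory sense.\<close>

definition adjoint_solution ::
  "real \<Rightarrow> (real \<Rightarrow> real^'n^'n) \<Rightarrow> (real \<Rightarrow> real^'m^'n) \<Rightarrow> (real \<Rightarrow> real^'n^'m) \<Rightarrow>
    (real \<Rightarrow> real^'n) \<Rightarrow> (real \<Rightarrow> real^'m) \<Rightarrow> (real \<Rightarrow> real^'n) \<Rightarrow> (real \<Rightarrow> real^'m) \<Rightarrow> bool"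
  where "adjoint_solution T A B C \<psi>y \<psi>z \<phi>y \<phi>z \<longleftrightarrow>
    abs_continuous_on 0 T \<phi>y \<and> L2_on T \<phi>z \<and>
    (AE t in lebesgue_on {0..T}.
      (\<phi>y has_vector_derivative
         - (transpose (A t) *v \<phi>y t + transpose (C t) *v \<phi>z t + \<psi>y t)) (at t) \<and>
      0 = transpose (B t) *v \<phi>y t + \<psi>z t) \<and>
    \<phi>y T = - ((transpose (C T) ** matrix_inv (transpose (B T) ** transpose (C T))) *v \<psi>z T)"

end

theory Submission
  imports Defs
begin

text \<open>Write \<open>e = y - Y\<close> and \<open>ez = z - Z\<close>, and let \<open>A\<close>, \<open>B\<close>, \<open>C\<close> be the averaged Jacobians of the adjoint
  problem. By the fundamental theorem of calculus along the segment from \<open>(Y, Z)\<close> to \<open>(y, z)\<close> they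
  linearise the equations exactly: \<open>f(y,z) - f(Y,Z) = A e + B ez\<close>, and \<open>- g(Y) = C e\<close> because
  \<open>g(y) = 0\<close>. Testing the adjoint equations with \<open>e\<close> and \<open>ez\<close> and moving the matrices to the other side
  of the inner products yields, for almost every \<open>t\<close>,
  \<open>e \<bullet> \<psi>y + ez \<bullet> \<psi>z = - e \<bullet> \<phi>y' - (f(y,z) - f(Y,Z)) \<bullet> \<phi>y + g(Y) \<bullet> \<phi>z\<close>.
  Integrating over \<open>[0,T]\<close>, the first term on the right is integrated by parts, which produces
  \<open>\<phi>y(0) \<bullet> e(0)\<close> and the integral of \<open>(f(y,z) - Y') \<bullet> \<phi>y\<close>; the terms with \<open>f(y,z)\<close> cancel and the residuals
  remain. The boundary term at \<open>T\<close> vanishes by the choice of \<open>\<phi>y(T)\<close>: it pairs a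
  vector with \<open>C(T) e(T) = g(y(T)) - g(Y(T))\<close>, which is zero because the implicit Euler method
  enforces the constraint at \<open>t = T\<close>.

  The analytic work lies in the integration by parts
  (\<open>integration_by_parts_lipschitz_abs_continuous\<close>), as \<open>\<phi>y\<close> is only absolutely continuous and
  \<open>Y\<close> only piecewise differentiable. It rests on the fundamental theorem of calculus for absolutely
  continuous functions (\<open>abs_continuous_FTC\<close>), applied to \<open>e \<bullet> \<phi>y\<close>. The exact linearisation is in
  \<open>f_increment_eq_averaged_jacobians\<close> and \<open>g_increment_eq_averaged_jacobian\<close>.\<close>

section \<open>Absolutely continuous functions\<close>

lemma sum_length_le_measure:
  fixes P :: "(real \<times> real) set"
  assumes "finite P" "\<And>p q. (p, q) \<in> P \<Longrightarrow> p \<le> q \<and> {p<..<q} \<subseteq> U"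
    and "pairwise (\<lambda>I J. {fst I<..<snd I} \<inter> {fst J<..<snd J} = {}) P"
    and U: "U \<in> lmeasurable"
  shows "(\<Sum>(p, q)\<in>P. q - p) \<le> measure lebesgue U"
proof -
  have "measure lebesgue (\<Union>I\<in>P. {fst I<..<snd I}) = (\<Sum>I\<in>P. measure lebesgue {fst I<..<snd I})"
    using assms by (intro measure_UNION') (auto simp: disjnt_def pairwise_def)
  also have "\<dots> = (\<Sum>(p, q)\<in>P. q - p)"
    using assms(2) by (intro sum.cong) (auto split: prod.splits)
  finally have "(\<Sum>(p, q)\<in>P. q - p) = measure lebesgue (\<Union>I\<in>P. {fst I<..<snd I})" ..
  also have "\<dots> \<le> measure lebesgue U"
  proof (rule measure_mono_fmeasurable[OF _ _ U])
    show "(\<Union>I\<in>P. {fst I<..<snd I}) \<subseteq> U"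
      by (rule UN_least) (metis assms(2) prod.collapse)
  qed (use assms(1) in auto)
  finally show ?thesis .
qed

lemma negligible_outer_open:
  fixes S :: "real set"
  assumes "negligible S" "\<delta> > 0"
  obtains U where "open U" "S \<subseteq> U" "U \<in> lmeasurable" "measure lebesgue U < \<delta>"
proof -
  have S: "S \<in> null_sets lebesgue"
    using assms by (simp add: negligible_iff_null_sets)
  obtain U where U: "open U" "S \<subseteq> U" "U - S \<in> lmeasurable" "emeasure lebesgue (U - S) < ennreal \<delta>"
    using sets_lebesgue_outer_open[of S \<delta>] S assms by blast
  have Seq: "U = (U - S) \<union> S" using U(2) by blast
  have "S \<in> lmeasurable" "measure lebesgue S = 0"
    using assms(1) by (auto simp: negligible_iff_measure)
  then have "U \<in> lmeasurable" and "measure lebesgue U \<le> measure lebesgue (U - S)"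
    using U(3) Seq measure_Un_le[of "U - S" lebesgue S] fmeasurable.Un[of "U - S" lebesgue S]
    by (auto dest: fmeasurableD simp: negligible_iff_null_sets)
  moreover have "measure lebesgue (U - S) < \<delta>"
    using U(3,4) assms(2) by (simp add: emeasure_eq_measure2 ennreal_less_iff)
  ultimately have "U \<in> lmeasurable" "measure lebesgue U < \<delta>" by auto
  then show thesis
    using U that by blast
qed

text \<open>The Henstock-Kurzweil integral makes this direct, since only Riemann sums have to be compared
  with \<open>w b - w a\<close>, which telescopes over any tagged division. The gauge is chosen separately for
  good and for exceptional tags. At a tag where \<open>w\<close> has derivative \<open>h\<close>, the increment of \<open>w\<close> over a
  short cell differs from the corresponding term of the Riemann sum by at most \<open>\<epsilon>'\<close> times the length
  of the cell. At an exceptional tag, the cell is forced into an open set of measure less than \<open>\<delta>\<close>,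
  so that absolute continuity bounds the sum of all increments over such cells; their Riemann terms
  vanish after the integrand has been set to zero on the exceptional set.\<close>
lemma abs_continuous_FTC:
  fixes w :: "real \<Rightarrow> 'a::banach"
  assumes ab: "a \<le> b" and ac: "abs_continuous_on a b w" and S: "negligible S"
    and deriv: "\<And>t. t \<in> {a..b} - S \<Longrightarrow> (w has_vector_derivative h t) (at t within {a..b})"
  shows "(h has_integral (w b - w a)) {a..b}"
proof -
  define h' where "h' t = (if t \<in> S then 0 else h t)" for t
  have "(h' has_integral (w b - w a)) {a..b}"
    unfolding has_integral_real
  proof (intro allI impI)
    fix \<epsilon> :: real assume "\<epsilon> > 0"
    define \<epsilon>' where "\<epsilon>' = \<epsilon> / (2 * (b - a + 1))"
    have \<epsilon>': "\<epsilon>' > 0" "\<epsilon>' * (b - a) \<le> \<epsilon> / 2"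
      using ab \<open>\<epsilon> > 0\<close> by (auto simp: \<epsilon>'_def field_simps)
    obtain \<delta> where "\<delta> > 0" and \<delta>: "\<forall>P. finite P \<and> (\<forall>(p, q)\<in>P. a \<le> p \<and> p \<le> q \<and> q \<le> b) \<and>
        pairwise (\<lambda>I J. {fst I<..<snd I} \<inter> {fst J<..<snd J} = {}) P \<and>
        (\<Sum>(p, q)\<in>P. q - p) < \<delta> \<longrightarrow> (\<Sum>(p, q)\<in>P. norm (w q - w p)) < \<epsilon> / 2"
      using ac[unfolded abs_continuous_on_def, THEN spec, THEN mp, OF half_gt_zero[OF \<open>\<epsilon> > 0\<close>]]
      by (elim exE conjE) (rule that; assumption)
    obtain U where U: "open U" "S \<subseteq> U" "U \<in> lmeasurable" "measure lebesgue U < \<delta>"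
      using negligible_outer_open[OF S \<open>\<delta> > 0\<close>] .
    have "\<exists>d>0. (t \<in> S \<longrightarrow> ball t d \<subseteq> U) \<and> (t \<in> {a..b} - S \<longrightarrow>
        (\<forall>s\<in>{a..b}. norm (s - t) < d \<longrightarrow> norm (w s - w t - (s - t) *\<^sub>R h t) \<le> \<epsilon>' * norm (s - t)))" for t
    proof (cases "t \<in> S")
      case True
      then show ?thesis using U by (meson DiffD2 open_contains_ball subsetD)
    next
      case False
      then show ?thesis
      proof (cases "t \<in> {a..b}")
        case True
        with False deriv[of t] \<epsilon>' show ?thesis
          unfolding has_vector_derivative_def has_derivative_within_alt by blast
      qed (use zero_less_one in blast)
    qed
    then obtain d where d0: "\<And>t. d t > 0" and dS: "\<And>t. t \<in> S \<Longrightarrow> ball t (d t) \<subseteq> U"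
      and dD: "\<And>t s. t \<in> {a..b} - S \<Longrightarrow> s \<in> {a..b} \<Longrightarrow> norm (s - t) < d t \<Longrightarrow>
          norm (w s - w t - (s - t) *\<^sub>R h t) \<le> \<epsilon>' * norm (s - t)"
      by metis
    show "\<exists>\<gamma>. gauge \<gamma> \<and> (\<forall>\<D>. \<D> tagged_division_of {a..b} \<and> \<gamma> fine \<D> \<longrightarrow>
        norm ((\<Sum>(x, K)\<in>\<D>. measure lborel K *\<^sub>R h' x) - (w b - w a)) < \<epsilon>)"
    proof (intro exI conjI allI impI)
      show "gauge (\<lambda>t. ball t (d t))"
        using d0 gauge_ball_dependent by blast
      fix p assume "p tagged_division_of {a..b} \<and> (\<lambda>t. ball t (d t)) fine p"
      then have p: "p tagged_division_of {a..b}" and fine: "(\<lambda>t. ball t (d t)) fine p" by auto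
      have fin: "finite p" using p by auto
      have cell: "x \<in> K \<and> K = {Inf K..Sup K} \<and> Inf K \<le> Sup K \<and> a \<le> Inf K \<and> Sup K \<le> b \<and> K \<subseteq> ball x (d x)
          \<and> measure lborel K = Sup K - Inf K"
        if xK: "(x, K) \<in> p" for x K
      proof -
        obtain u v where "K = cbox u v" "x \<in> K" "K \<subseteq> {a..b}"
          using p xK by (meson tagged_division_ofD(2,3,4))
        then show ?thesis using fine xK by (auto simp: fine_def)
      qed
      have ba: "b - a = (\<Sum>(x,K)\<in>p. Sup K - Inf K)" "w b - w a = (\<Sum>(x,K)\<in>p. w (Sup K) - w (Inf K))"
        using additive_tagged_division_1[OF ab p, of "\<lambda>x. x"] additive_tagged_division_1[OF ab p, of w]
        by auto
      \<comment> \<open>\<open>q\<close> holds the cells with exceptional tag, \<open>r\<close> turns a cell into its pair of end points.\<close>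
      define q where "q = {(x, K). (x, K) \<in> p \<and> x \<in> S}"
      have qp: "q \<subseteq> p" and finq: "finite q" using fin by (auto simp: q_def intro: finite_subset)
      define r where "r = (\<lambda>(x::real, K::real set). (Inf K, Sup K))"
      have nonov: "{Inf K<..<Sup K} \<inter> {Inf L<..<Sup L} = {}"
        if "(x, K) \<in> p" "(t, L) \<in> p" "(x, K) \<noteq> (t, L)" for x K t L
        using tagged_division_ofD(5)[OF p that] cell[OF that(1)] cell[OF that(2)]
        by (metis interior_atLeastAtMost_real)
      have disj: "pairwise (\<lambda>I J. {fst I<..<snd I} \<inter> {fst J<..<snd J} = {}) (r ` q)"
        unfolding pairwise_def
      proof (intro ballI impI)
        fix I J assume "I \<in> r ` q" "J \<in> r ` q" "I \<noteq> J"
        then obtain x K t L where "(x, K) \<in> p" "(t, L) \<in> p" "I = (Inf K, Sup K)" "J = (Inf L, Sup L)"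
          by (auto simp: r_def q_def)
        then show "{fst I<..<snd I} \<inter> {fst J<..<snd J} = {}"
          using nonov[of x K t L] \<open>I \<noteq> J\<close> by auto
      qed
      have "(\<Sum>(u, v)\<in>r ` q. v - u) \<le> measure lebesgue U"
      proof (rule sum_length_le_measure[OF _ _ disj U(3)])
        show "finite (r ` q)" using finq by simp
        show "u \<le> v \<and> {u<..<v} \<subseteq> U" if uv: "(u, v) \<in> r ` q" for u v
        proof -
          obtain x K where x: "(x, K) \<in> p" "x \<in> S" "u = Inf K" "v = Sup K"
            using uv by (auto simp: q_def r_def)
          have "{u<..<v} \<subseteq> K" using cell[OF x(1)] x(3,4) greaterThanLessThan_subseteq_atLeastAtMost_iff
            by (metis order_refl)
          then show ?thesis using cell[OF x(1)] dS[OF x(2)] x by auto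
        qed
      qed
      then have "(\<Sum>(u, v)\<in>r ` q. v - u) < \<delta>" using U(4) by linarith
      then have small: "(\<Sum>(u, v)\<in>r ` q. norm (w v - w u)) < \<epsilon> / 2"
      proof -
        have "\<forall>(u, v)\<in>r ` q. a \<le> u \<and> u \<le> v \<and> v \<le> b"
          using cell by (auto simp: r_def q_def)
        then show ?thesis
          using \<delta>[rule_format, OF conjI[OF finite_imageI[OF finq] conjI[OF _ conjI[OF disj]]]]
            \<open>(\<Sum>(u, v)\<in>r ` q. v - u) < \<delta>\<close> by blast
      qed
      have reindex: "(\<Sum>(u, v)\<in>r ` q. norm (w v - w u)) = (\<Sum>(x, K)\<in>q. norm (w (Sup K) - w (Inf K)))"
      \<comment> \<open>Two tagged cells with the same end points do not overlap, so they are degenerate and contribute 0.\<close>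
      proof (subst sum.reindex_nontrivial[OF finq])
        fix X Y assume X: "X \<in> q" "Y \<in> q" "X \<noteq> Y" "r X = r Y"
        obtain x K t L where XY: "X = (x, K)" "Y = (t, L)" by fastforce
        then have "{Inf K<..<Sup K} = {}"
          using nonov[of x K t L] X qp by (auto simp: r_def)
        then have "Inf K = Sup K" using cell[of x K] X XY qp by fastforce
        then show "(case r X of (u, v) \<Rightarrow> norm (w v - w u)) = 0" by (simp add: r_def XY)
      qed (simp add: r_def case_prod_beta)
      have bad: "norm (\<Sum>(x, K)\<in>q. measure lborel K *\<^sub>R h' x - (w (Sup K) - w (Inf K))) < \<epsilon> / 2"
      proof -
        have "norm (\<Sum>(x, K)\<in>q. measure lborel K *\<^sub>R h' x - (w (Sup K) - w (Inf K)))
          \<le> (\<Sum>(x, K)\<in>q. norm (w (Sup K) - w (Inf K)))"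
          by (rule sum_norm_le) (auto simp: q_def h'_def norm_minus_commute)
        then show ?thesis using small reindex by linarith
      qed
      have good: "norm (\<Sum>(x, K)\<in>p - q. measure lborel K *\<^sub>R h' x - (w (Sup K) - w (Inf K))) \<le> \<epsilon> / 2"
      proof -
        have "norm (\<Sum>(x, K)\<in>p - q. measure lborel K *\<^sub>R h' x - (w (Sup K) - w (Inf K)))
          \<le> (\<Sum>(x, K)\<in>p - q. \<epsilon>' * (Sup K - Inf K))"
        proof (rule sum_norm_le, clarify)
          fix x K assume xK: "(x, K) \<in> p" "(x, K) \<notin> q"
          note c = cell[OF xK(1)]
          have xS: "x \<notin> S" using xK by (auto simp: q_def)
          have x: "Inf K \<le> x" "x \<le> Sup K" using c by (metis atLeastAtMost_iff)+
          have "Inf K \<in> ball x (d x)" "Sup K \<in> ball x (d x)"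
            using c by (metis atLeastAtMost_iff order_refl subsetD)+
          then have l: "norm (w (Inf K) - w x - (Inf K - x) *\<^sub>R h x) \<le> \<epsilon>' * norm (Inf K - x)"
            and r: "norm (w (Sup K) - w x - (Sup K - x) *\<^sub>R h x) \<le> \<epsilon>' * norm (Sup K - x)"
            using c x xS dD[of x "Inf K"] dD[of x "Sup K"] by (auto simp: dist_norm norm_minus_commute)
          have "measure lborel K = Sup K - Inf K" using c by blast
          then have "measure lborel K *\<^sub>R h' x - (w (Sup K) - w (Inf K)) =
             (w (Inf K) - w x - (Inf K - x) *\<^sub>R h x) - (w (Sup K) - w x - (Sup K - x) *\<^sub>R h x)"
            using xS by (simp add: h'_def scaleR_diff_left)
          also have "norm \<dots> \<le> \<epsilon>' * norm (Inf K - x) + \<epsilon>' * norm (Sup K - x)"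
            using l r by (rule norm_triangle_le_diff[OF add_mono])
          also have "\<dots> = \<epsilon>' * (Sup K - Inf K)" using x by (simp add: algebra_simps)
          finally show "norm (measure lborel K *\<^sub>R h' x - (w (Sup K) - w (Inf K))) \<le> \<epsilon>' * (Sup K - Inf K)" .
        qed
        also have "\<dots> \<le> (\<Sum>(x, K)\<in>p. \<epsilon>' * (Sup K - Inf K))"
          using fin \<epsilon>'(1) cell by (intro sum_mono2) auto
        also have "\<dots> = \<epsilon>' * (b - a)"
          unfolding ba(1) by (simp add: sum_distrib_left case_prod_beta)
        finally show ?thesis using \<epsilon>' by linarith
      qed
      have "(\<Sum>(x, K)\<in>p. measure lborel K *\<^sub>R h' x) - (w b - w a)
          = (\<Sum>(x, K)\<in>p. measure lborel K *\<^sub>R h' x - (w (Sup K) - w (Inf K)))"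
        unfolding ba(2) by (simp add: sum_subtractf case_prod_beta)
      also have "\<dots> = (\<Sum>(x, K)\<in>p - q. measure lborel K *\<^sub>R h' x - (w (Sup K) - w (Inf K)))
          + (\<Sum>(x, K)\<in>q. measure lborel K *\<^sub>R h' x - (w (Sup K) - w (Inf K)))"
        using qp fin by (rule sum.subset_diff)
      also have "norm \<dots> < \<epsilon>" using norm_triangle_le[OF order_refl] good bad
        by (smt (verit) norm_triangle_ineq field_sum_of_halves)
      finally show "norm ((\<Sum>(x, K)\<in>p. measure lborel K *\<^sub>R h' x) - (w b - w a)) < \<epsilon>" .
    qed
  qed
  then show ?thesis
    by (rule has_integral_spike[OF S, rotated]) (auto simp: h'_def)
qed

lemma abs_continuous_on_imp_continuous_on:
  assumes "abs_continuous_on a b u"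
  shows "continuous_on {a..b} u"
proof (rule continuous_onI)
  fix t \<epsilon> :: real assume t: "t \<in> {a..b}" and "\<epsilon> > 0"
  obtain \<delta> where "\<delta> > 0" and \<delta>: "\<forall>P. finite P \<and> (\<forall>(p, q)\<in>P. a \<le> p \<and> p \<le> q \<and> q \<le> b) \<and>
      pairwise (\<lambda>I J. {fst I<..<snd I} \<inter> {fst J<..<snd J} = {}) P \<and>
      (\<Sum>(p, q)\<in>P. q - p) < \<delta> \<longrightarrow> (\<Sum>(p, q)\<in>P. norm (u q - u p)) < \<epsilon>"
    using assms[unfolded abs_continuous_on_def, THEN spec, THEN mp, OF \<open>\<epsilon> > 0\<close>]
    by (elim exE conjE) (rule that; assumption)
  have "dist (u s) (u t) \<le> \<epsilon>" if "s \<in> {a..b}" "dist s t < \<delta>" for s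
    using \<delta>[THEN spec, of "{(min s t, max s t)}"] that t
    by (cases "s \<le> t") (auto simp: dist_norm norm_minus_commute min_def max_def)
  then show "\<exists>d>0. \<forall>s\<in>{a..b}. dist s t < d \<longrightarrow> dist (u s) (u t) \<le> \<epsilon>"
    using \<open>\<delta> > 0\<close> by blast
qed

lemma abs_continuous_on_inner_lipschitz:
  fixes u v :: "real \<Rightarrow> 'a::real_inner"
  assumes u: "abs_continuous_on a b u" and v: "L-lipschitz_on {a..b} v"
  shows "abs_continuous_on a b (\<lambda>t. v t \<bullet> u t)"
proof -
  have "bounded (u ` {a..b})"
    using abs_continuous_on_imp_continuous_on[OF u]
    by (intro compact_imp_bounded compact_continuous_image) auto
  then obtain Mu where Mu: "Mu > 0" "\<And>t. t \<in> {a..b} \<Longrightarrow> norm (u t) \<le> Mu"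
    by (auto simp: bounded_pos)
  have "bounded (v ` {a..b})"
    using lipschitz_on_continuous_on[OF v]
    by (intro compact_imp_bounded compact_continuous_image) auto
  then obtain Mv where Mv: "Mv > 0" "\<And>t. t \<in> {a..b} \<Longrightarrow> norm (v t) \<le> Mv"
    by (auto simp: bounded_pos)
  have L: "L \<ge> 0" using v by (rule lipschitz_on_nonneg)
  have incr: "norm (v q \<bullet> u q - v p \<bullet> u p) \<le> Mv * norm (u q - u p) + Mu * L * (q - p)"
    if "a \<le> p" "p \<le> q" "q \<le> b" for p q
  proof -
    have "v q \<bullet> u q - v p \<bullet> u p = v q \<bullet> (u q - u p) + (v q - v p) \<bullet> u p"
      by (simp add: inner_diff_left inner_diff_right)
    also have "norm \<dots> \<le> norm (v q) * norm (u q - u p) + norm (v q - v p) * norm (u p)"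
      by (intro norm_triangle_mono) (simp_all add: Cauchy_Schwarz_ineq2)
    also have "\<dots> \<le> Mv * norm (u q - u p) + (L * (q - p)) * Mu"
    proof (intro add_mono mult_mono)
      show "norm (v q - v p) \<le> L * (q - p)"
        using lipschitz_onD[OF v, of q p] that by (auto simp: dist_norm)
    qed (use that L Mu Mv in auto)
    finally show ?thesis by (simp add: algebra_simps)
  qed
  show ?thesis
    unfolding abs_continuous_on_def
  proof (intro allI impI)
    fix \<epsilon> :: real assume "\<epsilon> > 0"
    then have "\<epsilon> / (2 * Mv) > 0" using Mv by simp
    obtain \<delta> where "\<delta> > 0" and \<delta>: "\<forall>P. finite P \<and> (\<forall>(p, q)\<in>P. a \<le> p \<and> p \<le> q \<and> q \<le> b) \<and>
        pairwise (\<lambda>I J. {fst I<..<snd I} \<inter> {fst J<..<snd J} = {}) P \<and>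
        (\<Sum>(p, q)\<in>P. q - p) < \<delta> \<longrightarrow> (\<Sum>(p, q)\<in>P. norm (u q - u p)) < \<epsilon> / (2 * Mv)"
      using u[unfolded abs_continuous_on_def, THEN spec, THEN mp, OF \<open>\<epsilon> / (2 * Mv) > 0\<close>]
      by (elim exE conjE) (rule that; assumption)
    \<comment> \<open>By \<open>incr\<close>, increments of \<open>u\<close> may use up \<open>\<epsilon> / 2\<close>, and the total length of the intervals, weighted by
      \<open>Mu * L\<close>, the other half; adding 1 keeps the denominator positive.\<close>
    define \<eta> where "\<eta> = min \<delta> (\<epsilon> / (2 * (Mu * L + 1)))"
    have MuL: "Mu * L \<ge> 0" using Mu L by simp
    have "\<eta> > 0" using \<open>\<delta> > 0\<close> \<open>\<epsilon> > 0\<close> MuL by (simp add: \<eta>_def)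
    have \<eta>: "Mu * L * \<eta> \<le> \<epsilon> / 2"
    proof -
      have "Mu * L * \<eta> \<le> (Mu * L + 1) * (\<epsilon> / (2 * (Mu * L + 1)))"
        using MuL \<open>\<eta> > 0\<close> by (intro mult_mono) (auto simp: \<eta>_def)
      also have "\<dots> = \<epsilon> / 2" using MuL by (simp add: field_simps)
      finally show ?thesis .
    qed
    show "\<exists>\<eta>>0. \<forall>P. finite P \<and> (\<forall>(p, q)\<in>P. a \<le> p \<and> p \<le> q \<and> q \<le> b) \<and>
        pairwise (\<lambda>I J. {fst I<..<snd I} \<inter> {fst J<..<snd J} = {}) P \<and>
        (\<Sum>(p, q)\<in>P. q - p) < \<eta> \<longrightarrow> (\<Sum>(p, q)\<in>P. norm (v q \<bullet> u q - v p \<bullet> u p)) < \<epsilon>"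
    proof (intro exI[of _ \<eta>] conjI allI impI, fact)
      fix P :: "(real \<times> real) set" assume P: "finite P \<and> (\<forall>(p, q)\<in>P. a \<le> p \<and> p \<le> q \<and> q \<le> b) \<and>
        pairwise (\<lambda>I J. {fst I<..<snd I} \<inter> {fst J<..<snd J} = {}) P \<and> (\<Sum>(p, q)\<in>P. q - p) < \<eta>"
      then have less: "(\<Sum>(p, q)\<in>P. norm (u q - u p)) < \<epsilon> / (2 * Mv)"
        using \<delta>[THEN spec, of P] by (simp add: \<eta>_def)
      have "(\<Sum>(p, q)\<in>P. norm (v q \<bullet> u q - v p \<bullet> u p))
          \<le> (\<Sum>(p, q)\<in>P. Mv * norm (u q - u p) + Mu * L * (q - p))"
        using P incr by (intro sum_mono) auto
      also have "\<dots> = Mv * (\<Sum>(p, q)\<in>P. norm (u q - u p)) + Mu * L * (\<Sum>(p, q)\<in>P. q - p)"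
        by (simp add: sum.distrib sum_distrib_left case_prod_beta)
      also have "\<dots> < Mv * (\<epsilon> / (2 * Mv)) + Mu * L * \<eta>"
        using less P Mv(1) MuL by (intro add_less_le_mono mult_strict_left_mono mult_left_mono) auto
      also have "\<dots> \<le> \<epsilon>" using \<eta> Mv(1) by simp
      finally show "(\<Sum>(p, q)\<in>P. norm (v q \<bullet> u q - v p \<bullet> u p)) < \<epsilon>" .
    qed
  qed
qed

section \<open>Piecewise linear interpolation\<close>

lemma pl_interp_cell:
  assumes T: "T > 0" and k: "k < N" and t: "real k * (T / real N) \<le> t" "t \<le> real (Suc k) * (T / real N)"
  shows "pl_interp T N v t = v k + ((t - real k * (T / real N)) / (T / real N)) *\<^sub>R (v (Suc k) - v k)"
proof -
  define h where "h = T / real N"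
  have h: "h > 0" using T k by (simp add: h_def)
  have tk: "real k \<le> t / h" "t / h \<le> real k + 1"
    using t h by (auto simp: h_def[symmetric] field_simps)
  have frac: "t / h - real k = (t - real k * h) / h"
    using h by (simp add: field_simps)
  show ?thesis
  proof (cases "t / h < real k + 1")
    case True
    then have "nat \<lfloor>t / h\<rfloor> = k"
      using tk by (metis floor_eq2 floor_unique nat_int of_int_of_nat_eq)
    then have "min (nat \<lfloor>t / h\<rfloor>) (N - 1) = k" using k by simp
    then have "pl_interp T N v t = (1 - (t / h - real k)) *\<^sub>R v k + (t / h - real k) *\<^sub>R v (Suc k)"
      by (simp only: pl_interp_def Let_def h_def[symmetric])
    also have "\<dots> = v k + (t / h - real k) *\<^sub>R (v (Suc k) - v k)"
      by (simp add: algebra_simps)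
    finally show ?thesis
      using frac by (simp only: h_def[symmetric])
  next
    \<comment> \<open>At the right end point the formula of the next cell applies, unless the cap keeps the index at \<open>N - 1\<close>.\<close>
    case False
    then have eq: "t / h = real (Suc k)" using tk by simp
    then have fl: "nat \<lfloor>t / h\<rfloor> = Suc k" by simp
    have "pl_interp T N v t = v (Suc k)"
    proof (cases "Suc k = N")
      case True
      then show ?thesis using fl eq
        by (auto simp: pl_interp_def Let_def h_def[symmetric])
    next
      case False
      then have "min (Suc k) (N - 1) = Suc k" using k by auto
      then show ?thesis using fl eq
        by (simp add: pl_interp_def Let_def h_def[symmetric])
    qed
    moreover have "(t - real k * h) / h = 1" using eq h by (simp add: field_simps)
    ultimately show ?thesis by (simp add: h_def[symmetric])
  qed
qed

lemma grid_cells_cover: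
  assumes T: "T > 0" and N: "N \<ge> 1"
  shows "{0..T} \<subseteq> (\<Union>k<N. {real k * (T / real N)..real (Suc k) * (T / real N)})"
proof
  fix t assume t: "t \<in> {0..T}"
  define h where "h = T / real N"
  have h: "h > 0" and Th: "T = real N * h" using T N by (auto simp: h_def)
  define k where "k = min (nat \<lfloor>t / h\<rfloor>) (N - 1)"
  have nn: "0 \<le> t / h" using t h by simp
  have "real (nat \<lfloor>t / h\<rfloor>) \<le> t / h" using nn by (simp add: of_nat_nat)
  then have "real k \<le> t / h" unfolding k_def by (smt (verit) min.cobounded1 of_nat_mono)
  moreover have "t / h \<le> real (Suc k)"
  proof (cases "nat \<lfloor>t / h\<rfloor> \<le> N - 1")
    case True
    then show ?thesis using nn by (simp add: k_def of_nat_nat) linarith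
  next
    case False
    then have "Suc k = N" using N by (simp add: k_def)
    then show ?thesis using t Th h by (simp add: field_simps)
  qed
  moreover have "k < N" using N by (auto simp: k_def)
  ultimately show "t \<in> (\<Union>k<N. {real k * (T / real N)..real (Suc k) * (T / real N)})"
    using h by (auto simp: h_def[symmetric] field_simps intro!: bexI[of _ k])
qed

lemma pl_interp_lipschitz:
  fixes v :: "nat \<Rightarrow> 'a::real_normed_vector"
  assumes T: "T > 0" and N: "N \<ge> 1"
  obtains L where "L-lipschitz_on {0..T} (pl_interp T N v)"
proof -
  define h where "h = T / real N"
  have h: "h > 0" using T N by (simp add: h_def)
  define L where "L = (\<Sum>k<N. norm (v (Suc k) - v k) / h)"
  have "L-lipschitz_on {0..T} (pl_interp T N v)"
  proof (rule lipschitz_on_closed_Union[OF _ _ _ _ grid_cells_cover[OF T N]])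
    show "L \<ge> 0" using h by (auto simp: L_def intro!: sum_nonneg)
    fix k assume k: "k \<in> {..<N}"
    have le: "norm (v (Suc k) - v k) / h \<le> L"
      unfolding L_def using k h by (intro member_le_sum) auto
    show "L-lipschitz_on {real k * (T / real N)..real (Suc k) * (T / real N)} (pl_interp T N v)"
    proof (rule lipschitz_onI[OF _ \<open>L \<ge> 0\<close>])
      fix s t assume st: "s \<in> {real k * (T / real N)..real (Suc k) * (T / real N)}"
         "t \<in> {real k * (T / real N)..real (Suc k) * (T / real N)}"
      have "pl_interp T N v s - pl_interp T N v t = ((s - t) / h) *\<^sub>R (v (Suc k) - v k)"
        using st k h
        by (simp add: pl_interp_cell[OF T] h_def[symmetric] diff_divide_distrib scaleR_left_diff_distrib del: of_nat_Suc)
      then have "dist (pl_interp T N v s) (pl_interp T N v t) = (norm (v (Suc k) - v k) / h) * dist s t"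
        using h by (simp add: dist_norm)
      also have "\<dots> \<le> L * dist s t" using le by (intro mult_right_mono) auto
      finally show "dist (pl_interp T N v s) (pl_interp T N v t) \<le> L * dist s t" .
    qed
  qed auto
  then show thesis by (rule that)
qed

lemma pl_interp_differentiable_off_grid:
  assumes T: "T > 0" and N: "N \<ge> 1" and t: "t \<in> {0..T} - (\<lambda>k. real k * (T / real N)) ` {..N}"
  shows "pl_interp T N v differentiable (at t)"
proof -
  define h where "h = T / real N"
  obtain k where k: "k < N" "t \<in> {real k * h..real (Suc k) * h}"
    using grid_cells_cover[OF T N] t unfolding h_def by blast
  have "t \<noteq> real k * h" "t \<noteq> real (Suc k) * h"
    using t k(1) unfolding h_def by (auto simp del: of_nat_Suc)
  then have t': "t \<in> {real k * h<..<real (Suc k) * h}" using k by auto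
  have "h \<noteq> 0" using T N by (simp add: h_def)
  then have "(\<lambda>s. v k + ((s - real k * h) / h) *\<^sub>R (v (Suc k) - v k)) differentiable (at t)"
    by (intro derivative_intros) (auto simp: divide_inverse intro!: derivative_intros)
  then obtain D where D: "((\<lambda>s. v k + ((s - real k * h) / h) *\<^sub>R (v (Suc k) - v k)) has_derivative D) (at t)"
    by (auto simp: differentiable_def)
  have "(pl_interp T N v has_derivative D) (at t)"
    by (rule has_derivative_transform_within_open[OF D open_greaterThanLessThan t'])
      (use pl_interp_cell[OF T k(1), of _ v] in \<open>auto simp: h_def\<close>)
  then show ?thesis
    by (auto simp: differentiable_def)
qed

section \<open>Exact linearisation by averaged Jacobians\<close>

text \<open>This transfers continuity of a matrix-valued Jacobian to the operator norm, in which the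
  criterion for total differentiability by continuous partial derivatives requires it.\<close>
lemma bounded_linear_blinfun_matrix:
  "bounded_linear (\<lambda>M :: real^'n^'m. Blinfun (\<lambda>v. M *v v))"
proof -
  define L where "L M = Blinfun (\<lambda>v. M *v v)" for M :: "real^'n^'m"
  have L: "blinfun_apply (L M) v = M *v v" for M v
    unfolding L_def by (subst bounded_linear_Blinfun_apply) (simp_all add: linear_conv_bounded_linear[symmetric])
  have "linear L"
    by (intro linearI blinfun_eqI)
      (simp_all add: L blinfun.add_left blinfun.scaleR_left matrix_vector_mult_add_rdistrib scaleR_matrix_vector_assoc)
  then show ?thesis by (simp add: linear_conv_bounded_linear L_def[abs_def])
qed

lemma has_derivative_continuous_jacobians:
  fixes F :: "real^'n \<Rightarrow> real^'m \<Rightarrow> real^'k"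
  assumes S: "open S" "(a, b) \<in> S"
    and A: "\<And>x y. (x, y) \<in> S \<Longrightarrow> ((\<lambda>x'. F x' y) has_derivative (\<lambda>v. A x y *v v)) (at x)"
    and B: "\<And>x y. (x, y) \<in> S \<Longrightarrow> ((\<lambda>y'. F x y') has_derivative (\<lambda>v. B x y *v v)) (at y)"
    and cont: "continuous_on S (\<lambda>(x, y). B x y)"
  shows "((\<lambda>(x, y). F x y) has_derivative (\<lambda>(u, v). A a b *v u + B a b *v v)) (at (a, b))"
proof -
  obtain U V where "open U" "open V" "(a, b) \<in> U \<times> V" "U \<times> V \<subseteq> S"
    by (rule open_prod_elim[OF S])
  then have UV: "open U" "open V" "a \<in> U" "b \<in> V" "U \<times> V \<subseteq> S" by auto
  obtain r where r: "r > 0" "ball b r \<subseteq> V" using UV(2,4) open_contains_ball by blast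
  have sub: "U \<times> ball b r \<subseteq> S" using UV r by blast
  define B' where "B' x y = Blinfun (\<lambda>v. B x y *v v)" for x y
  have B': "blinfun_apply (B' x y) = (\<lambda>v. B x y *v v)" for x y
    unfolding B'_def by (rule bounded_linear_Blinfun_apply) (simp add: linear_conv_bounded_linear[symmetric])
  have "((\<lambda>(x, y). F x y) has_derivative (\<lambda>(u, v). A a b *v u + B' a b v)) (at (a, b) within U \<times> ball b r)"
  proof (rule has_derivative_partialsI[where f = F and fy = B' and fx = "\<lambda>v. A a b *v v"])
    show "((\<lambda>x. F x b) has_derivative (\<lambda>v. A a b *v v)) (at a within U)"
      using A[OF S(2)] by (rule has_derivative_at_withinI)
    show "((\<lambda>y. F x y) has_derivative blinfun_apply (B' x y)) (at y within ball b r)"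
      if "x \<in> U" "y \<in> ball b r" for x y
    proof -
      have "(x, y) \<in> S" using sub that by blast
      from has_derivative_at_withinI[OF B[OF this]] show ?thesis unfolding B' .
    qed
    have "continuous_on S (\<lambda>p. Blinfun (\<lambda>v. (case p of (x, y) \<Rightarrow> B x y) *v v))"
      by (rule bounded_linear.continuous_on[OF bounded_linear_blinfun_matrix cont])
    then have "continuous_on S (\<lambda>(x, y). B' x y)"
      by (simp add: B'_def split_def)
    from continuous_on_subset[OF this sub] have "continuous_on (U \<times> ball b r) (\<lambda>(x, y). B' x y)" .
    then show "continuous (at (a, b) within U \<times> ball b r) (\<lambda>(x, y). B' x y)"
      using UV r by (simp add: continuous_on_eq_continuous_within)
  qed (use r in auto)
  moreover have "at (a, b) within U \<times> ball b r = at (a, b)"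
    using UV r by (intro at_within_open) (auto intro: open_Times)
  ultimately show ?thesis by (simp add: B')
qed

lemma integral_matrix_vector_mult:
  fixes M :: "real \<Rightarrow> real^'n^'m"
  assumes "M integrable_on S"
  shows "((\<lambda>s. M s *v v) has_integral (integral S M *v v)) S"
proof -
  have "bounded_linear (\<lambda>M :: real^'n^'m. M *v v)"
    by (auto intro!: linearI simp: linear_conv_bounded_linear[symmetric] matrix_vector_mult_add_rdistrib scaleR_matrix_vector_assoc)
  from has_integral_linear[OF integrable_integral[OF assms] this]
  show ?thesis by (simp add: o_def)
qed

lemma segment_has_vector_derivative:
  fixes a b :: "'a::real_normed_vector"
  shows "((\<lambda>s. s *\<^sub>R a + (1 - s) *\<^sub>R b) has_vector_derivative (a - b)) (at s within X)"
  by (auto intro!: derivative_eq_intros simp: has_vector_derivative_def algebra_simps)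

lemma open_time_slice:
  fixes D :: "('a::topological_space \<times> 'b::topological_space \<times> real) set"
  assumes D: "openin (top_of_set (UNIV \<times> UNIV \<times> {0..T})) D" and t: "t \<in> {0..T}"
  shows "open {(x, y). (x, y, t) \<in> D}"
proof -
  obtain S where S: "open S" "D = (UNIV \<times> UNIV \<times> {0..T}) \<inter> S"
    using D by (auto simp: openin_open)
  have "{(x, y). (x, y, t) \<in> D} = (\<lambda>p. (fst p, snd p, t)) -` S"
    using S t by auto
  also have "open \<dots>"
    by (rule open_vimage[OF S(1)]) (intro continuous_intros)
  finally show ?thesis .
qed

text \<open>The fundamental theorem of calculus along the segment from \<open>(Y t, Z t)\<close> to \<open>(y t, z t)\<close>:
  the increment is the integral over \<open>s\<close> of the derivative of \<open>f\<close> along the segment, and the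
  constant vectors \<open>y t - Y t\<close> and \<open>z t - Z t\<close> can be pulled out of the integral. So the averaged
  Jacobians linearise \<open>f\<close> without remainder.\<close>
lemma f_increment_eq_averaged_jacobians:
  fixes f :: "real^'n \<Rightarrow> real^'m \<Rightarrow> real \<Rightarrow> real^'n"
  assumes smooth: "smooth_f T D f" and t: "t \<in> {0..T}"
    and seg: "\<And>s. s \<in> {0..1} \<Longrightarrow> (s *\<^sub>R y t + (1 - s) *\<^sub>R Y t, s *\<^sub>R z t + (1 - s) *\<^sub>R Z t, t) \<in> D"
  shows "f (y t) (z t) t - f (Y t) (Z t) t
    = fbar_y f y z Y Z t *v (y t - Y t) + fbar_z f y z Y Z t *v (z t - Z t)"
proof -
  define p where "p s = s *\<^sub>R y t + (1 - s) *\<^sub>R Y t" for s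
  define q where "q s = s *\<^sub>R z t + (1 - s) *\<^sub>R Z t" for s
  have seg': "(p s, q s, t) \<in> D" if "s \<in> {0..1}" for s
    using seg[OF that] by (simp add: p_def q_def)
  note sm = smooth[unfolded smooth_f_def]
  have cont_fy: "continuous_on D (\<lambda>(a, b, t). f_y f a b t)" and cont_fz: "continuous_on D (\<lambda>(a, b, t). f_z f a b t)"
    using sm by blast+
  have cont_pq: "continuous_on {0..1} (\<lambda>s. (p s, q s, t))"
    unfolding p_def q_def by (intro continuous_intros)
  have img: "(\<lambda>s. (p s, q s, t)) ` {0..1} \<subseteq> D" using seg' by blast
  have cont: "continuous_on {0..1} (\<lambda>s. f_y f (p s) (q s) t)" "continuous_on {0..1} (\<lambda>s. f_z f (p s) (q s) t)"
    using continuous_on_compose2[OF cont_fy cont_pq img] continuous_on_compose2[OF cont_fz cont_pq img]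
    by (simp_all only: prod.case)
  have int: "((\<lambda>s. f_y f (p s) (q s) t *v (y t - Y t) + f_z f (p s) (q s) t *v (z t - Z t)) has_integral
      (fbar_y f y z Y Z t *v (y t - Y t) + fbar_z f y z Y Z t *v (z t - Z t))) {0..1}"
    unfolding fbar_y_def fbar_z_def p_def[symmetric] q_def[symmetric]
    by (rule has_integral_add[OF integral_matrix_vector_mult[OF integrable_continuous_interval[OF cont(1)]]
          integral_matrix_vector_mult[OF integrable_continuous_interval[OF cont(2)]]])
  define S where "S = {(x, y). (x, y, t) \<in> D}"
  have open_S: "open S" unfolding S_def using sm t by (intro open_time_slice) auto
  have joint: "((\<lambda>(x, y). f x y t) has_derivative (\<lambda>(u, v). f_y f x y t *v u + f_z f x y t *v v)) (at (x, y))"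
    if "(x, y) \<in> S" for x y
  proof (rule has_derivative_continuous_jacobians[OF open_S that])
    show "((\<lambda>x'. f x' y t) has_derivative (\<lambda>v. f_y f x y t *v v)) (at x)"
      "((\<lambda>y'. f x y' t) has_derivative (\<lambda>v. f_z f x y t *v v)) (at y)" if "(x, y) \<in> S" for x y
      using sm that unfolding f_y_def f_z_def jacobian_works[symmetric] S_def by auto
    show "continuous_on S (\<lambda>(x, y). f_z f x y t)"
    proof -
      have cont: "continuous_on S (\<lambda>r. (fst r, snd r, t))" by (intro continuous_intros)
      have img: "(\<lambda>r. (fst r, snd r, t)) ` S \<subseteq> D" by (auto simp: S_def)
      show ?thesis
        using continuous_on_compose2[OF cont_fz cont img] by (simp add: case_prod_beta)
    qed
  qed
  have deriv: "((\<lambda>s. f (p s) (q s) t) has_vector_derivative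
      f_y f (p s) (q s) t *v (y t - Y t) + f_z f (p s) (q s) t *v (z t - Z t)) (at s within {0..1})"
    if s: "s \<in> {0..1}" for s
  proof -
    define G where "G = (\<lambda>(x, y). f x y t)"
    have inner: "((\<lambda>s. (p s, q s)) has_derivative (\<lambda>h. (h *\<^sub>R (y t - Y t), h *\<^sub>R (z t - Z t)))) (at s within {0..1})"
      unfolding p_def q_def
      by (rule has_derivative_Pair[OF segment_has_vector_derivative[unfolded has_vector_derivative_def]
            segment_has_vector_derivative[unfolded has_vector_derivative_def]])
    have "(p s, q s) \<in> S" using seg'[OF s] by (simp add: S_def)
    then have outer: "(G has_derivative (\<lambda>(u, v). f_y f (p s) (q s) t *v u + f_z f (p s) (q s) t *v v)) (at (p s, q s))"
      unfolding G_def by (rule joint)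
    have "((\<lambda>s. G (p s, q s)) has_derivative (\<lambda>h. case (h *\<^sub>R (y t - Y t), h *\<^sub>R (z t - Z t)) of
        (u, v) \<Rightarrow> f_y f (p s) (q s) t *v u + f_z f (p s) (q s) t *v v)) (at s within {0..1})"
      by (rule has_derivative_compose[of "\<lambda>s. (p s, q s)" _ s _ G, OF inner outer])
    then show ?thesis
      by (simp add: G_def has_vector_derivative_def matrix_vector_mult_scaleR scaleR_add_right)
  qed
  have "((\<lambda>s. f_y f (p s) (q s) t *v (y t - Y t) + f_z f (p s) (q s) t *v (z t - Z t)) has_integral
      f (p 1) (q 1) t - f (p 0) (q 0) t) {0..1}"
    by (rule fundamental_theorem_of_calculus[OF zero_le_one deriv])
  from has_integral_unique[OF int this] show ?thesis
    by (simp add: p_def q_def)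
qed

lemma g_increment_eq_averaged_jacobian:
  fixes g :: "real^'n \<Rightarrow> real \<Rightarrow> real^'m"
  assumes smooth: "smooth_g T E g"
    and seg: "\<And>s. s \<in> {0..1} \<Longrightarrow> (s *\<^sub>R y t + (1 - s) *\<^sub>R Y t, t) \<in> E"
  shows "g (y t) t - g (Y t) t = gbar_y g y Y t *v (y t - Y t)"
proof -
  define p where "p s = s *\<^sub>R y t + (1 - s) *\<^sub>R Y t" for s
  have seg': "(p s, t) \<in> E" if "s \<in> {0..1}" for s
    using seg[OF that] by (simp add: p_def)
  note sm = smooth[unfolded smooth_g_def]
  then have cont_gy: "continuous_on E (\<lambda>(a, t). g_y g a t)" by blast
  have cont_p: "continuous_on {0..1} (\<lambda>s. (p s, t))"
    unfolding p_def by (intro continuous_intros)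
  have img: "(\<lambda>s. (p s, t)) ` {0..1} \<subseteq> E" using seg' by blast
  have cont: "continuous_on {0..1} (\<lambda>s. g_y g (p s) t)"
    using continuous_on_compose2[OF cont_gy cont_p img] by (simp only: prod.case)
  have int: "((\<lambda>s. g_y g (p s) t *v (y t - Y t)) has_integral gbar_y g y Y t *v (y t - Y t)) {0..1}"
    unfolding gbar_y_def p_def[symmetric]
    by (rule integral_matrix_vector_mult[OF integrable_continuous_interval[OF cont]])
  have deriv: "((\<lambda>s. g (p s) t) has_vector_derivative g_y g (p s) t *v (y t - Y t)) (at s within {0..1})"
    if s: "s \<in> {0..1}" for s
  proof -
    have outer: "((\<lambda>a. g a t) has_derivative (\<lambda>v. g_y g (p s) t *v v)) (at (p s))"
      using sm seg'[OF s] unfolding g_y_def jacobian_works[symmetric] by auto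
    have inner: "(p has_derivative (\<lambda>h. h *\<^sub>R (y t - Y t))) (at s within {0..1})"
      using segment_has_vector_derivative unfolding p_def has_vector_derivative_def .
    show ?thesis
      using has_derivative_compose[of p _ s "{0..1}" "\<lambda>a. g a t", OF inner outer]
      by (simp add: has_vector_derivative_def matrix_vector_mult_scaleR)
  qed
  have "((\<lambda>s. g_y g (p s) t *v (y t - Y t)) has_integral
      g (p 1) t - g (p 0) t) {0..1}"
    by (rule fundamental_theorem_of_calculus[OF zero_le_one deriv])
  from has_integral_unique[OF int this] show ?thesis
    by (simp add: p_def)
qed

section \<open>Square integrable functions\<close>

lemma continuous_inner_L2_integrable:
  fixes c u :: "real \<Rightarrow> 'a::euclidean_space"
  assumes c: "continuous_on {0..T} c" and u: "L2_on T u"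
  shows "integrable (lebesgue_on {0..T}) (\<lambda>t. c t \<bullet> u t)"
proof -
  have "bounded (c ` {0..T})"
    using c by (intro compact_imp_bounded compact_continuous_image) auto
  then obtain M where M: "M > 0" "\<And>t. t \<in> {0..T} \<Longrightarrow> norm (c t) \<le> M"
    by (auto simp: bounded_pos)
  interpret finite_measure "lebesgue_on {0..T}"
    by (rule finite_measure_lebesgue_on) simp
  show ?thesis
  proof (rule Bochner_Integration.integrable_bound)
    show "integrable (lebesgue_on {0..T}) (\<lambda>t. M * (1 + (norm (u t))\<^sup>2))"
      using u by (auto simp: L2_on_def intro!: integrable_mult_right Bochner_Integration.integrable_add)
    show "(\<lambda>t. c t \<bullet> u t) \<in> borel_measurable (lebesgue_on {0..T})"
      using u by (intro borel_measurable_inner continuous_imp_measurable_on_sets_lebesgue[OF c])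
        (auto simp: L2_on_def)
    show "AE t in lebesgue_on {0..T}. norm (c t \<bullet> u t) \<le> norm (M * (1 + (norm (u t))\<^sup>2))"
    proof (rule AE_I2)
      fix t assume "t \<in> space (lebesgue_on {0..T})"
      then have "norm (c t) \<le> M" using M by simp
      have "0 \<le> (norm (u t) - 1 / 2)\<^sup>2" by simp
      then have "norm (u t) \<le> 1 + (norm (u t))\<^sup>2"
        by (simp add: power2_eq_square algebra_simps)
      then have "norm (c t) * norm (u t) \<le> M * (1 + (norm (u t))\<^sup>2)"
        using \<open>norm (c t) \<le> M\<close> M by (intro mult_mono) auto
      then show "norm (c t \<bullet> u t) \<le> norm (M * (1 + (norm (u t))\<^sup>2))"
        using Cauchy_Schwarz_ineq2[of "c t" "u t"] M(1) by auto
    qed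
  qed
qed

lemma ip_diff_left:
  fixes a b u :: "real \<Rightarrow> 'a::euclidean_space"
  assumes "continuous_on {0..T} a" "continuous_on {0..T} b" "L2_on T u"
  shows "ip T (\<lambda>t. a t - b t) u = ip T a u - ip T b u"
  using assms by (simp add: ip_def inner_diff_left continuous_inner_L2_integrable)

lemma continuous_imp_L2_on:
  fixes c :: "real \<Rightarrow> 'a::euclidean_space"
  assumes "continuous_on {0..T} c"
  shows "L2_on T c"
proof -
  have "integrable (lebesgue_on {0..T}) (\<lambda>t. (norm (c t))\<^sup>2)"
    using assms by (intro continuous_imp_integrable_real continuous_intros)
  then show ?thesis
    using assms by (auto simp: L2_on_def intro: continuous_imp_measurable_on_sets_lebesgue)
qed

section \<open>Integration by parts\<close>

lemma lipschitz_on_vector_derivative_bound: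
  fixes u :: "real \<Rightarrow> 'a::real_normed_vector"
  assumes lip: "L-lipschitz_on {a..b} u" and t: "t \<in> {a<..<b}"
    and deriv: "(u has_vector_derivative u') (at t)"
  shows "norm u' \<le> L"
proof -
  have "norm u' \<le> L + \<epsilon>" if "\<epsilon> > 0" for \<epsilon>
  proof -
    from deriv that obtain d where d: "d > 0"
      "\<And>s. norm (s - t) < d \<Longrightarrow> norm (u s - u t - (s - t) *\<^sub>R u') \<le> \<epsilon> * norm (s - t)"
      unfolding has_vector_derivative_def has_derivative_at_alt by blast
    define s where "s = t + min (d / 2) (b - t)"
    have s: "s \<in> {a..b}" "s > t" "norm (s - t) < d"
      using t d(1) by (auto simp: s_def)
    have "(s - t) * norm u' = norm ((u s - u t) - (u s - u t - (s - t) *\<^sub>R u'))"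
      using s by simp
    also have "\<dots> \<le> norm (u s - u t) + norm (u s - u t - (s - t) *\<^sub>R u')"
      by (rule norm_triangle_ineq4)
    also have "\<dots> \<le> L * (s - t) + \<epsilon> * (s - t)"
      using lipschitz_onD[OF lip s(1), of t] d(2)[OF s(3)] s t by (auto simp: dist_norm intro!: add_mono)
    also have "\<dots> = (s - t) * (L + \<epsilon>)" by (simp add: algebra_simps)
    finally show ?thesis using s by simp
  qed
  then show ?thesis by (rule field_le_epsilon)
qed

lemma bounded_vector_derivative_imp_lipschitz:
  fixes u :: "real \<Rightarrow> 'a::real_normed_vector"
  assumes deriv: "\<And>t. t \<in> {a..b} \<Longrightarrow> (u has_vector_derivative u' t) (at t within {a..b})"
    and cont: "continuous_on {a..b} u'"
  obtains L where "L-lipschitz_on {a..b} u"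
proof -
  have "bounded (u' ` {a..b})"
    using cont by (intro compact_imp_bounded compact_continuous_image) auto
  then obtain L where L: "L > 0" "\<And>t. t \<in> {a..b} \<Longrightarrow> norm (u' t) \<le> L"
    by (auto simp: bounded_pos)
  have "L-lipschitz_on {a..b} u"
  proof (rule bounded_derivative_imp_lipschitz)
    show "(u has_derivative (\<lambda>h. h *\<^sub>R u' t)) (at t within {a..b})" if "t \<in> {a..b}" for t
      using deriv[OF that] by (simp add: has_vector_derivative_def)
    show "onorm (\<lambda>h. h *\<^sub>R u' t) \<le> L" if "t \<in> {a..b}" for t
      using L that by (intro onorm_bound) (auto simp: mult.commute[of L] intro: mult_left_mono)
  qed (use L in auto)
  then show thesis by (rule that)
qed

text \<open>The fundamental theorem for \<open>e t \<bullet> \<phi> t\<close> gives the integral of the sum of both terms of the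
  product rule. The term with \<open>\<phi>'\<close> agrees almost everywhere with the integrable \<open>R\<close>; hence the other
  one is Henstock-Kurzweil integrable, and it is Lebesgue integrable because \<open>e'\<close> is bounded by the
  Lipschitz constant of \<open>e\<close>.\<close>
lemma integration_by_parts_lipschitz_abs_continuous:
  fixes e \<phi> :: "real \<Rightarrow> 'a::euclidean_space"
  assumes T: "T > 0" and lip: "L-lipschitz_on {0..T} e" and ac: "abs_continuous_on 0 T \<phi>"
    and S: "negligible S"
    and de: "\<And>t. t \<in> {0..T} - S \<Longrightarrow> (e has_vector_derivative e' t) (at t)"
    and d\<phi>: "\<And>t. t \<in> {0..T} - S \<Longrightarrow> (\<phi> has_vector_derivative \<phi>' t) (at t)"
    and R: "\<And>t. t \<in> {0..T} - S \<Longrightarrow> e t \<bullet> \<phi>' t = R t" "integrable (lebesgue_on {0..T}) R"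
  shows "integrable (lebesgue_on {0..T}) (\<lambda>t. e' t \<bullet> \<phi> t)"
    and "(LINT t|lebesgue_on {0..T}. e' t \<bullet> \<phi> t) + (LINT t|lebesgue_on {0..T}. R t)
      = e T \<bullet> \<phi> T - e 0 \<bullet> \<phi> 0"
proof -
  let ?I = "LINT t|lebesgue_on {0..T}. R t"
  define S' where "S' = S \<union> {0, T}"
  have S': "negligible S'" using S by (simp add: S'_def)
  have "((\<lambda>t. e' t \<bullet> \<phi> t + R t) has_integral (e T \<bullet> \<phi> T - e 0 \<bullet> \<phi> 0)) {0..T}"
  proof (rule abs_continuous_FTC[OF _ abs_continuous_on_inner_lipschitz[OF ac lip] S])
    fix t assume t: "t \<in> {0..T} - S"
    from has_derivative_inner[OF de[OF t, unfolded has_vector_derivative_def] d\<phi>[OF t, unfolded has_vector_derivative_def]]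
    have "((\<lambda>t. e t \<bullet> \<phi> t) has_vector_derivative (e' t \<bullet> \<phi> t + R t)) (at t)"
      by (simp add: has_vector_derivative_def R(1)[OF t, symmetric] algebra_simps)
    then show "((\<lambda>t. e t \<bullet> \<phi> t) has_vector_derivative (e' t \<bullet> \<phi> t + R t)) (at t within {0..T})"
      by (rule has_vector_derivative_at_within)
  qed (use T in simp)
  from has_integral_diff[OF this has_integral_integral_lebesgue_on[OF R(2)]]
  have int: "((\<lambda>t. e' t \<bullet> \<phi> t) has_integral (e T \<bullet> \<phi> T - e 0 \<bullet> \<phi> 0 - ?I)) {0..T}"
    by simp
  have "bounded (\<phi> ` {0..T})"
    using abs_continuous_on_imp_continuous_on[OF ac]
    by (intro compact_imp_bounded compact_continuous_image) auto
  then obtain M where M: "M > 0" "\<And>t. t \<in> {0..T} \<Longrightarrow> norm (\<phi> t) \<le> M"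
    by (auto simp: bounded_pos)
  \<comment> \<open>Where \<open>e'\<close> is not controlled by the Lipschitz constant, including both end points, it is replaced by 0.\<close>
  define d where "d t = (if t \<in> S' then 0 else e' t \<bullet> \<phi> t)" for t
  have "d integrable_on {0..T}"
    using int S' by (intro integrable_spike[OF has_integral_integrable[OF int] S']) (auto simp: d_def)
  then have "d absolutely_integrable_on {0..T}"
  proof (rule absolutely_integrable_integrable_bound[rotated])
    fix t assume t: "t \<in> {0..T}"
    show "norm (d t) \<le> L * M"
    proof (cases "t \<in> S'")
      case True
      then show ?thesis using M lipschitz_on_nonneg[OF lip] by (simp add: d_def)
    next
      case False
      then have "norm (e' t) \<le> L"
        using t by (intro lipschitz_on_vector_derivative_bound[OF lip _ de]) (auto simp: S'_def)
      then have "norm (e' t) * norm (\<phi> t) \<le> L * M"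
        using M t lipschitz_on_nonneg[OF lip] by (intro mult_mono) auto
      then show ?thesis
        using Cauchy_Schwarz_ineq2[of "e' t" "\<phi> t"] False by (simp add: d_def)
    qed
  qed auto
  then have "(\<lambda>t. e' t \<bullet> \<phi> t) absolutely_integrable_on {0..T}"
    by (rule absolutely_integrable_spike[OF _ S']) (auto simp: d_def)
  then show *: "integrable (lebesgue_on {0..T}) (\<lambda>t. e' t \<bullet> \<phi> t)"
    by (rule absolutely_integrable_imp_integrable) simp
  show "(LINT t|lebesgue_on {0..T}. e' t \<bullet> \<phi> t) + ?I = e T \<bullet> \<phi> T - e 0 \<bullet> \<phi> 0"
    using has_integral_unique[OF int has_integral_integral_lebesgue_on[OF *]] by simp
qed

section \<open>The error representation\<close>

lemma AE_lebesgue_on_negligible: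
  assumes "AE t in lebesgue_on X. P t" "X \<in> sets lebesgue"
  obtains S where "negligible S" "\<And>t. t \<in> X - S \<Longrightarrow> P t"
proof -
  have "AE t in lebesgue. t \<in> X \<longrightarrow> P t"
    using assms by (simp add: AE_restrict_space_iff)
  then obtain S where "negligible S" "{t. \<not> (t \<in> X \<longrightarrow> P t)} \<subseteq> S"
    unfolding eventually_ae_filter_negligible by blast
  then show thesis by (intro that) auto
qed

lemma inner_transpose_mult: "x \<bullet> (transpose A *v v) = (A *v x) \<bullet> v" for A :: "real^'n^'m"
  by (metis dot_lmul_matrix inner_commute transpose_matrix_vector)

theorem theorem3p4:
  fixes f :: "real^'n \<Rightarrow> real^'m \<Rightarrow> real \<Rightarrow> real^'n"
    and g :: "real^'n \<Rightarrow> real \<Rightarrow> real^'m"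
    and D :: "((real^'n) \<times> (real^'m) \<times> real) set" and E :: "((real^'n) \<times> real) set"
    and T :: real and N :: nat
    and y Y \<psi>y \<phi>y :: "real \<Rightarrow> real^'n" and z Z \<psi>z \<phi>z :: "real \<Rightarrow> real^'m"
    and Yn :: "nat \<Rightarrow> real^'n" and Zn :: "nat \<Rightarrow> real^'m"
  assumes T: "T > 0" and N: "N \<ge> 1"
    and smooth: "smooth_f T D f" "smooth_g T E g"
    and sol: "dae_solution T f g y z"
    and index2: "hessenberg_index2 T D E f g y z"
    and num: "Yn 0 = y 0" "Zn 0 = z 0" "bdf1 T N f g Yn Zn"
    and interp: "Y = pl_interp T N Yn" "Z = pl_interp T N Zn"
    and segment: "\<And>s t. s \<in> {0..1} \<Longrightarrow> t \<in> {0..T} \<Longrightarrow>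
        (s *\<^sub>R y t + (1 - s) *\<^sub>R Y t, s *\<^sub>R z t + (1 - s) *\<^sub>R Z t, t) \<in> D \<and>
        (s *\<^sub>R y t + (1 - s) *\<^sub>R Y t, t) \<in> E"
    and close: "\<And>t. t \<in> {0..T} \<Longrightarrow>
        invertible (transpose (fbar_z f y z Y Z t) ** transpose (gbar_y g y Y t))"
    and psi: "L2_on T \<psi>y" "L2_on T \<psi>z" "continuous (at T within {0..T}) \<psi>z"
    and adj: "adjoint_solution T (fbar_y f y z Y Z) (fbar_z f y z Y Z) (gbar_y g y Y)
        \<psi>y \<psi>z \<phi>y \<phi>z"
  shows "QoI T \<psi>y \<psi>z y z - QoI T \<psi>y \<psi>z Y Z
           = ip T (\<lambda>t. y t - Y t) \<psi>y + ip T (\<lambda>t. z t - Z t) \<psi>z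
       \<and> QoI T \<psi>y \<psi>z y z - QoI T \<psi>y \<psi>z Y Z
           = \<phi>y 0 \<bullet> (y 0 - Y 0)
             + ip T \<phi>y (\<lambda>t. f (Y t) (Z t) t - vector_derivative Y (at t))
             + ip T \<phi>z (\<lambda>t. g (Y t) t)"
proof -
  note seg = segment[THEN conjunct1] and segE = segment[THEN conjunct2]
  define e where "e t = y t - Y t" for t
  define ez where "ez t = z t - Z t" for t
  define F where "F t = f (y t) (z t) t" for t
  define F' where "F' t = f (Y t) (Z t) t" for t
  define G where "G t = g (Y t) t" for t
  have dy: "(y has_vector_derivative F t) (at t within {0..T})" and gy: "g (y t) t = 0"
    if "t \<in> {0..T}" for t
    using sol that by (auto simp: dae_solution_def F_def)
  have inD: "(y t, z t, t) \<in> D" "(Y t, Z t, t) \<in> D" "(Y t, t) \<in> E" if "t \<in> {0..T}" for t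
    using seg[of 1 t] seg[of 0 t] segE[of 0 t] that by auto
  obtain LY LZ where LY: "LY-lipschitz_on {0..T} Y" and LZ: "LZ-lipschitz_on {0..T} Z"
    unfolding interp using pl_interp_lipschitz[OF T N] by metis
  have cont: "continuous_on {0..T} y" "continuous_on {0..T} z" "continuous_on {0..T} Y" "continuous_on {0..T} Z"
    "continuous_on {0..T} \<phi>y"
    using continuous_on_vector_derivative[OF dy] sol lipschitz_on_continuous_on[OF LY]
      lipschitz_on_continuous_on[OF LZ] adj abs_continuous_on_imp_continuous_on
    by (auto simp: dae_solution_def adjoint_solution_def)
  have contf: "continuous_on D (\<lambda>(a, b, t). f a b t)" and contg: "continuous_on E (\<lambda>(a, t). g a t)"
    using smooth unfolding smooth_f_def smooth_g_def by blast+
  have cont_F: "continuous_on {0..T} F"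
  proof -
    have c: "continuous_on {0..T} (\<lambda>t. (y t, z t, t))" using cont by (intro continuous_intros)
    have i: "(\<lambda>t. (y t, z t, t)) ` {0..T} \<subseteq> D" using inD by blast
    show ?thesis using continuous_on_compose2[OF contf c i] unfolding F_def by (simp only: prod.case)
  qed
  have cont_F': "continuous_on {0..T} F'"
  proof -
    have c: "continuous_on {0..T} (\<lambda>t. (Y t, Z t, t))" using cont by (intro continuous_intros)
    have i: "(\<lambda>t. (Y t, Z t, t)) ` {0..T} \<subseteq> D" using inD by blast
    show ?thesis using continuous_on_compose2[OF contf c i] unfolding F'_def by (simp only: prod.case)
  qed
  have cont_G: "continuous_on {0..T} G"
  proof -
    have c: "continuous_on {0..T} (\<lambda>t. (Y t, t))" using cont by (intro continuous_intros)
    have i: "(\<lambda>t. (Y t, t)) ` {0..T} \<subseteq> E" using inD by blast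
    show ?thesis using continuous_on_compose2[OF contg c i] unfolding G_def by (simp only: prod.case)
  qed
  have cont_e: "continuous_on {0..T} e" "continuous_on {0..T} ez"
    unfolding e_def ez_def using cont by (auto intro!: continuous_intros)
  have \<phi>z: "L2_on T \<phi>z" and ac: "abs_continuous_on 0 T \<phi>y"
    using adj by (auto simp: adjoint_solution_def)
  have \<phi>y: "L2_on T \<phi>y" by (rule continuous_imp_L2_on[OF cont(5)])

  have int_e: "integrable (lebesgue_on {0..T}) (\<lambda>t. e t \<bullet> \<psi>y t)"
    and int_ez: "integrable (lebesgue_on {0..T}) (\<lambda>t. ez t \<bullet> \<psi>z t)"
    and int_F: "integrable (lebesgue_on {0..T}) (\<lambda>t. (F t - F' t) \<bullet> \<phi>y t)"
    and int_G: "integrable (lebesgue_on {0..T}) (\<lambda>t. G t \<bullet> \<phi>z t)"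
    using cont_e cont_F cont_F' cont_G psi(1,2) \<phi>y \<phi>z
    by (auto intro!: continuous_inner_L2_integrable continuous_intros)
  \<comment> \<open>\<open>R\<close> is what \<open>e t \<bullet> \<phi>' t\<close>, with \<open>\<phi>'\<close> the derivative of \<open>\<phi>y\<close>, becomes by the adjoint equations and the exact linearisation; it
    only pairs continuous with square integrable functions.\<close>
  define R where "R t = G t \<bullet> \<phi>z t - (F t - F' t) \<bullet> \<phi>y t - ez t \<bullet> \<psi>z t - e t \<bullet> \<psi>y t" for t
  have int_R: "integrable (lebesgue_on {0..T}) R"
    unfolding R_def by (intro Bochner_Integration.integrable_diff int_e int_ez int_F int_G)
  have LINT_R: "(LINT t|lebesgue_on {0..T}. R t) = ip T G \<phi>z - ip T (\<lambda>t. F t - F' t) \<phi>y - ip T ez \<psi>z - ip T e \<psi>y"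
    unfolding R_def ip_def using int_e int_ez int_F int_G by simp

  define A where "A = fbar_y f y z Y Z"
  define B where "B = fbar_z f y z Y Z"
  define C where "C = gbar_y g y Y"
  define \<phi>' where "\<phi>' t = - (transpose (A t) *v \<phi>y t + transpose (C t) *v \<phi>z t + \<psi>y t)" for t
  have AB: "F t - F' t = A t *v e t + B t *v ez t" if "t \<in> {0..T}" for t
    using f_increment_eq_averaged_jacobians[of T D f t y Y z Z, OF smooth(1) that] seg that
    unfolding F_def F'_def A_def B_def e_def ez_def by blast
  have C: "- G t = C t *v e t" if "t \<in> {0..T}" for t
    using g_increment_eq_averaged_jacobian[of T E g y t Y, OF smooth(2)] segE that gy[OF that]
    unfolding G_def C_def e_def by (metis diff_0)
  have "AE t in lebesgue_on {0..T}. (\<phi>y has_vector_derivative \<phi>' t) (at t) \<and>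
      0 = transpose (B t) *v \<phi>y t + \<psi>z t"
    using adj unfolding adjoint_solution_def \<phi>'_def A_def B_def C_def by blast
  then obtain S0 where S0: "negligible S0" "\<And>t. t \<in> {0..T} - S0 \<Longrightarrow> (\<phi>y has_vector_derivative \<phi>' t) (at t) \<and>
      0 = transpose (B t) *v \<phi>y t + \<psi>z t"
    by (rule AE_lebesgue_on_negligible) auto
  define S where "S = S0 \<union> {0, T} \<union> (\<lambda>k. real k * (T / real N)) ` {..N}"
  have S: "negligible S" using S0 by (auto simp: S_def intro: negligible_finite)
  have R: "e t \<bullet> \<phi>' t = R t" if t: "t \<in> {0..T} - S" for t
  proof -
    have "transpose (B t) *v \<phi>y t = - \<psi>z t"
      using S0(2)[of t] t by (auto simp: S_def eq_neg_iff_add_eq_0)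
    then have "(B t *v ez t) \<bullet> \<phi>y t = - (ez t \<bullet> \<psi>z t)"
      using inner_transpose_mult[of "ez t" "B t" "\<phi>y t"] by (simp del: transpose_matrix_vector)
    then have "(A t *v e t) \<bullet> \<phi>y t = (F t - F' t) \<bullet> \<phi>y t + ez t \<bullet> \<psi>z t"
      using AB[of t] t by (simp add: inner_add_left)
    moreover have "(C t *v e t) \<bullet> \<phi>z t = - (G t \<bullet> \<phi>z t)"
      using C[of t] t by (metis DiffD1 inner_minus_left)
    ultimately show ?thesis
      by (simp add: R_def \<phi>'_def inner_add_right inner_diff_right inner_transpose_mult del: transpose_matrix_vector)
  qed
  define e' where "e' t = F t - vector_derivative Y (at t)" for t
  have de: "(e has_vector_derivative e' t) (at t)" if t: "t \<in> {0..T} - S" for t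
  proof -
    have "t \<in> interior {0..T}" using t by (auto simp: S_def)
    then have "(y has_vector_derivative F t) (at t)"
      using dy[of t] t at_within_interior[of t "{0..T}"] by simp
    moreover have "(Y has_vector_derivative vector_derivative Y (at t)) (at t)"
      using pl_interp_differentiable_off_grid[OF T N, of t Yn] t
      unfolding interp by (simp add: S_def vector_derivative_works[symmetric])
    ultimately show ?thesis
      unfolding e_def[abs_def] e'_def by (rule has_vector_derivative_diff)
  qed
  obtain Ly where Ly: "Ly-lipschitz_on {0..T} y"
    using bounded_vector_derivative_imp_lipschitz[OF dy cont_F] by blast
  have lip: "(Ly + LY)-lipschitz_on {0..T} e"
    unfolding e_def[abs_def] by (rule lipschitz_on_diff[OF Ly LY])
  have d\<phi>: "(\<phi>y has_vector_derivative \<phi>' t) (at t)" if "t \<in> {0..T} - S" for t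
    using S0(2)[of t] that by (auto simp: S_def)
  note parts = integration_by_parts_lipschitz_abs_continuous[OF T lip ac S de d\<phi> R int_R]

  \<comment> \<open>The boundary term at \<open>T\<close> drops out: \<open>\<phi>y T\<close> lies in the range of \<open>transpose (C T)\<close>, and \<open>C T *v e T\<close> is
    the increment of \<open>g\<close> between two points that both satisfy the constraint.\<close>
  have NT: "real N * (T / real N) = T" and N1: "Suc (N - 1) = N" using N by auto
  then have YT: "Y T = Yn N"
    using pl_interp_cell[OF T, of "N - 1" N T Yn] N T unfolding interp
    by (auto simp: field_simps of_nat_diff)
  have "g (Yn N) T = 0"
  proof -
    have "N - 1 < N" using N by simp
    with num(3) have "0 = g (Yn (Suc (N - 1))) (real (Suc (N - 1)) * (T / real N))"
      unfolding bdf1_def Let_def by blast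
    then show ?thesis using N1 NT by metis
  qed
  then have "C T *v e T = 0" using C[of T] T YT by (simp add: G_def)
  moreover have "\<phi>y T = - (transpose (C T) *v (matrix_inv (transpose (B T) ** transpose (C T)) *v \<psi>z T))"
    using adj by (simp add: adjoint_solution_def B_def C_def matrix_vector_mul_assoc)
  ultimately have eT: "e T \<bullet> \<phi>y T = 0"
    by (simp add: inner_transpose_mult del: transpose_matrix_vector)

  have residual: "ip T \<phi>y (\<lambda>t. F' t - vector_derivative Y (at t))
      = (LINT t|lebesgue_on {0..T}. e' t \<bullet> \<phi>y t) - ip T (\<lambda>t. F t - F' t) \<phi>y"
  proof -
    have "\<phi>y t \<bullet> (F' t - vector_derivative Y (at t)) = e' t \<bullet> \<phi>y t - (F t - F' t) \<bullet> \<phi>y t" for t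
      by (simp add: e'_def inner_diff_left inner_diff_right inner_commute)
    then show ?thesis
      using parts(1) int_F by (simp add: ip_def)
  qed
  have "ip T e \<psi>y + ip T ez \<psi>z
      = \<phi>y 0 \<bullet> e 0 + ip T \<phi>y (\<lambda>t. F' t - vector_derivative Y (at t)) + ip T \<phi>z G"
    using parts(2) LINT_R eT residual by (simp add: inner_commute ip_def)
  moreover have "QoI T \<psi>y \<psi>z y z - QoI T \<psi>y \<psi>z Y Z = ip T e \<psi>y + ip T ez \<psi>z"
    using cont psi by (simp add: QoI_def e_def[abs_def] ez_def[abs_def] ip_diff_left)
  ultimately show ?thesis
    by (simp add: e_def[abs_def] ez_def[abs_def] F'_def[abs_def] G_def[abs_def])
qed

end
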